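(* Let $\mathbf{A}=(A;\Omega)$ be an algebra with $A$ infinite and $\Omega$ finite, and let $\rho$ be a central relation on $A$ with center $Z$ such that every operation in $\Omega$ preserves $\rho$. Then $\mathbf{A}$ is not $1$-central polynomially complete: there exists a unary function $f:A\to A$ preserving $\rho$ which is not a unary polynomial function of $\mathbf{A}$.
   Context: An $n$-ary relation $\rho\subseteq A^n$ ($n\ge 2$) is central if there is a non-empty proper subset $Z\subsetneq A$ (the center) such that: (1) $(a_1,\dots,a_n)\in\rho$ whenever at least one $a_i\in Z$; (2) $\rho$ is invariant under permutations of coordinates; (3) $(a_1,\dots,a_n)\in\rho$ whenever $a_i=a_j$ for some distinct $i,j$. A function $g:A^m\to A$ preserves $\rho$ if, applied coordinatewise to any $m$ tuples of $\rho$, it yields a tuple of $\rho$. Unary polynomial functions of $\mathbf{A}$ are the functions $A\to A$ obtained from the identity and the constant functions by finitely many applications of the fundamental operations in $\Omega$. *)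

theory Defs
  imports "HOL-Library.NList" "HOL-Library.FuncSet" "HOL-Combinatorics.Permutations"
begin

text \<open>
  Tuples in \<open>A\<^sup>n\<close> are lists in \<^term>\<open>nlists n A\<close>. A finitary operation on \<open>A\<close> is a pair
  of its arity \<open>m\<close> and a function on lists, of which only the values on \<^term>\<open>nlists m A\<close>
  matter; nullary operations are allowed.
\<close>

type_synonym 'a operation = "nat \<times> ('a list \<Rightarrow> 'a)"

definition algebra :: "'a set \<Rightarrow> 'a operation set \<Rightarrow> bool" where
  "algebra A \<Omega> \<longleftrightarrow> (\<forall>(m, g) \<in> \<Omega>. \<forall>xs \<in> nlists m A. g xs \<in> A)"

definition central_relation :: "nat \<Rightarrow> 'a set \<Rightarrow> 'a set \<Rightarrow> 'a list set \<Rightarrow> bool" where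
  "central_relation n A Z \<rho> \<longleftrightarrow>
     n \<ge> 2 \<and> \<rho> \<subseteq> nlists n A \<and> Z \<noteq> {} \<and> Z \<subset> A \<and>
     (\<forall>xs \<in> nlists n A. (\<exists>i<n. xs ! i \<in> Z) \<longrightarrow> xs \<in> \<rho>) \<and>
     (\<forall>p. p permutes {..<n} \<longrightarrow> (\<forall>xs \<in> \<rho>. permute_list p xs \<in> \<rho>)) \<and>
     (\<forall>xs \<in> nlists n A. (\<exists>i<n. \<exists>j<n. i \<noteq> j \<and> xs ! i = xs ! j) \<longrightarrow> xs \<in> \<rho>)"

definition preserves :: "nat \<Rightarrow> 'a operation \<Rightarrow> 'a list set \<Rightarrow> bool" where
  "preserves n op \<rho> \<longleftrightarrow>
     (case op of (m, g) \<Rightarrow>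
       \<forall>ts \<in> nlists m \<rho>. map (\<lambda>i. g (map (\<lambda>t. t ! i) ts)) [0..<n] \<in> \<rho>)"

definition unary_operation :: "('a \<Rightarrow> 'a) \<Rightarrow> 'a operation" where
  "unary_operation f = (1, \<lambda>xs. f (hd xs))"

text \<open>
  Functions \<open>A \<rightarrow> A\<close> are represented by elements of \<^term>\<open>A \<rightarrow>\<^sub>E A\<close>, so that equality of such
  functions does not depend on values outside \<open>A\<close>.
\<close>

inductive_set unary_polynomials :: "'a set \<Rightarrow> 'a operation set \<Rightarrow> ('a \<Rightarrow> 'a) set"
  for A :: "'a set" and \<Omega> :: "'a operation set" where
  poly_identity: "(\<lambda>x\<in>A. x) \<in> unary_polynomials A \<Omega>"
| poly_constant: "c \<in> A \<Longrightarrow> (\<lambda>x\<in>A. c) \<in> unary_polynomials A \<Omega>"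
| poly_application: "\<lbrakk>(m, g) \<in> \<Omega>; length ps = m; \<forall>p \<in> set ps. p \<in> unary_polynomials A \<Omega>\<rbrakk>
    \<Longrightarrow> (\<lambda>x\<in>A. g (map (\<lambda>p. p x) ps)) \<in> unary_polynomials A \<Omega>"

definition one_central_polynomially_complete ::
    "nat \<Rightarrow> 'a set \<Rightarrow> 'a operation set \<Rightarrow> 'a list set \<Rightarrow> bool" where
  "one_central_polynomially_complete n A \<Omega> \<rho> \<longleftrightarrow>
     (\<forall>f \<in> A \<rightarrow>\<^sub>E A. preserves n (unary_operation f) \<rho> \<longrightarrow> f \<in> unary_polynomials A \<Omega>)"

end

(* Only countably many term shapes arise from finitely many operations, so the algebra has at most
   |A| unary polynomials. On the other hand, fix z in Z and a distinct from z. Every function from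
   A to {z, a} preserves the central relation: an image tuple either meets the center or is
   constant. There are 2^|A| such functions. *)
theory Submission
  imports Defs "HOL-Library.Equipollence"
begin

text \<open>A bridge to cardinal orders, whose absorption law for infinite sets gives the bound on
  unions.\<close>

lemma lepoll_iff_card_of_ordLeq: "A \<lesssim> B \<longleftrightarrow> (card_of A, card_of B) \<in> ordLeq"
  unfolding lepoll_def card_of_ordLeq ..

lemma UN_lepoll_infinite:
  assumes "infinite B" and "I \<lesssim> B" and "\<And>i. i \<in> I \<Longrightarrow> F i \<lesssim> B"
  shows "(\<Union>i\<in>I. F i) \<lesssim> B"
  using assms by (simp add: lepoll_iff_card_of_ordLeq card_of_UNION_ordLeq_infinite)

lemma Un_lepoll_infinite:
  assumes "infinite B" and "X \<lesssim> B" and "Y \<lesssim> B"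
  shows "X \<union> Y \<lesssim> B"
  using UN_lepoll_infinite[of B "UNIV :: bool set" "\<lambda>b. if b then X else Y"] assms
  by (simp add: UNIV_bool Un_commute finite_lepoll_infinite)

text \<open>Splitting off the head turns the lists of length \<open>Suc m\<close> into a union over
  \<open>X\<close> of copies of the lists of length \<open>m\<close>, so the bound on unions carries
  the induction.\<close>

lemma nlists_lepoll_infinite:
  assumes "infinite B" and "X \<lesssim> B"
  shows "nlists m X \<lesssim> B"
proof (induction m)
  case 0
  show ?case using \<open>infinite B\<close> by (simp add: finite_lepoll_infinite)
next
  case (Suc m)
  then show ?case
    unfolding nlists_Suc using assms
    by (intro UN_lepoll_infinite) (auto intro: lepoll_trans[OF image_lepoll])
qed

text \<open>Stratification by nesting depth. The stages are cumulative, so that arguments of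
  different depths can be gathered in one stage.\<close>

primrec unary_polynomials_upto :: "'a set \<Rightarrow> 'a operation set \<Rightarrow> nat \<Rightarrow> ('a \<Rightarrow> 'a) set" where
  "unary_polynomials_upto A \<Omega> 0 = insert (\<lambda>x\<in>A. x) ((\<lambda>c. \<lambda>x\<in>A. c) ` A)"
| "unary_polynomials_upto A \<Omega> (Suc k) = unary_polynomials_upto A \<Omega> k \<union>
     (\<Union>(m, g)\<in>\<Omega>. (\<lambda>ps. \<lambda>x\<in>A. g (map (\<lambda>p. p x) ps)) ` nlists m (unary_polynomials_upto A \<Omega> k))"

lemma mono_unary_polynomials_upto: "mono (unary_polynomials_upto A \<Omega>)"
  by (intro mono_iff_le_Suc[THEN iffD2]) simp

lemma unary_polynomials_subset_upto:
  "unary_polynomials A \<Omega> \<subseteq> (\<Union>k. unary_polynomials_upto A \<Omega> k)"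
proof
  fix f
  assume "f \<in> unary_polynomials A \<Omega>"
  then show "f \<in> (\<Union>k. unary_polynomials_upto A \<Omega> k)"
  proof induction
    case poly_identity
    have "(\<lambda>x\<in>A. x) \<in> unary_polynomials_upto A \<Omega> 0" by simp
    then show ?case by blast
  next
    case (poly_constant c)
    then have "(\<lambda>x\<in>A. c) \<in> unary_polynomials_upto A \<Omega> 0" by simp
    then show ?case by blast
  next
    case (poly_application m g ps)
    then have "\<forall>p\<in>set ps. \<exists>k. p \<in> unary_polynomials_upto A \<Omega> k" by blast
    then obtain depth where depth: "\<And>p. p \<in> set ps \<Longrightarrow> p \<in> unary_polynomials_upto A \<Omega> (depth p)"
      by metis
    \<comment> \<open>The inserted \<open>0\<close> keeps \<open>Max\<close> meaningful when
      \<open>ps\<close> is empty, that is, for a nullary operation.\<close>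
    define k where "k = Max (insert 0 (depth ` set ps))"
    have "p \<in> unary_polynomials_upto A \<Omega> k" if "p \<in> set ps" for p
      using depth[OF that] monoD[OF mono_unary_polynomials_upto, of "depth p" k] that
      by (auto simp: k_def)
    then have "ps \<in> nlists m (unary_polynomials_upto A \<Omega> k)"
      using poly_application by (auto intro: nlistsI)
    then have "(\<lambda>x\<in>A. g (map (\<lambda>p. p x) ps)) \<in> unary_polynomials_upto A \<Omega> (Suc k)"
      using \<open>(m, g) \<in> \<Omega>\<close> by auto
    then show ?case by blast
  qed
qed

text \<open>Stage 0 is the identity together with a copy of \<open>A\<close>. Each later stage adds,
  for every member of \<Omega>, an image of a set of lists over the previous stage, which stays
  within the size of \<open>A\<close>.\<close>

lemma unary_polynomials_lepoll:
  assumes "infinite A" and "\<Omega> \<lesssim> A"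
  shows "unary_polynomials A \<Omega> \<lesssim> A"
proof -
  have "unary_polynomials_upto A \<Omega> k \<lesssim> A" for k
  proof (induction k)
    case 0
    then show ?case
      using assms Un_lepoll_infinite[of A "{\<lambda>x\<in>A. x}" "(\<lambda>c. \<lambda>x\<in>A. c) ` A"]
      by (simp add: image_lepoll finite_lepoll_infinite)
  next
    case (Suc k)
    then show ?case
      using assms
      by (auto intro!: Un_lepoll_infinite UN_lepoll_infinite
          intro: lepoll_trans[OF image_lepoll] nlists_lepoll_infinite)
  qed
  \<comment> \<open>The stages are indexed by the naturals, which embed in the infinite set
    \<open>A\<close>.\<close>
  then have "(\<Union>k. unary_polynomials_upto A \<Omega> k) \<lesssim> A"
    using assms by (intro UN_lepoll_infinite) (simp_all flip: infinite_le_lepoll)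
  then show ?thesis
    using lepoll_trans[OF subset_imp_lepoll[OF unary_polynomials_subset_upto]] by blast
qed

lemma two_valued_preserves_central_relation:
  assumes \<rho>: "central_relation n A Z \<rho>" and "z \<in> Z" and "a \<in> A" and f: "f \<in> A \<rightarrow> {z, a}"
  shows "preserves n (unary_operation f) \<rho>"
proof -
  have "map (\<lambda>i. f (t ! i)) [0..<n] \<in> \<rho>" if "t \<in> \<rho>" for t
  proof -
    let ?xs = "map (\<lambda>i. f (t ! i)) [0..<n]"
    have n: "n \<ge> 2" and "t \<in> nlists n A" and "z \<in> A"
      using \<rho> that \<open>z \<in> Z\<close> unfolding central_relation_def by auto
    then have two_valued: "f (t ! i) \<in> {z, a}" if "i < n" for i
      using that f by (auto dest: nlistsE_nth_in)
    then have "?xs \<in> nlists n A"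
      using \<open>z \<in> A\<close> \<open>a \<in> A\<close> by (fastforce intro!: nlistsI)
    moreover have "(\<exists>i<n. ?xs ! i \<in> Z) \<or> (\<exists>i<n. \<exists>j<n. i \<noteq> j \<and> ?xs ! i = ?xs ! j)"
    proof (cases "\<exists>i<n. f (t ! i) = z")
      case True
      then show ?thesis using \<open>z \<in> Z\<close> by auto
    next
      case False
      \<comment> \<open>If \<open>z\<close> is never a value, all entries equal \<open>a\<close>;
        coordinates 0 and 1 both exist because \<open>n \<ge> 2\<close>.\<close>
      then have "?xs ! 0 = ?xs ! 1" using two_valued[of 0] two_valued[of 1] n by auto
      then show ?thesis using n by (intro disjI2 exI[of _ 0] exI[of _ 1] conjI) auto
    qed
    ultimately show ?thesis using \<rho> unfolding central_relation_def by blast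
  qed
  \<comment> \<open>A list of length 1 over \<rho> is a single tuple, so the entrywise image of one
    tuple is all there is to check.\<close>
  then show ?thesis
    by (auto simp: preserves_def unary_operation_def in_nlists_Suc_iff)
qed

theorem theorem5p1:
  fixes A Z :: "'a set" and \<Omega> :: "'a operation set" and n :: nat and \<rho> :: "'a list set"
  assumes "algebra A \<Omega>"
    and "infinite A"
    and "finite \<Omega>"
    and "central_relation n A Z \<rho>"
    and "\<forall>g \<in> \<Omega>. preserves n g \<rho>"
  shows "\<not> one_central_polynomially_complete n A \<Omega> \<rho> \<and>
    (\<exists>f \<in> A \<rightarrow>\<^sub>E A. preserves n (unary_operation f) \<rho> \<and> f \<notin> unary_polynomials A \<Omega>)"
proof -
  \<comment> \<open>The center is non-empty, which gives \<open>z\<close>, and proper in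
    \<open>A\<close>, which gives a second point \<open>a\<close>.\<close>
  obtain z a where "z \<in> Z" "z \<in> A" "a \<in> A" "z \<noteq> a"
    using assms(4) unfolding central_relation_def by blast
  define h where "h S = (\<lambda>x\<in>A. if x \<in> S then z else a)" for S
  have h_preserves: "h S \<in> A \<rightarrow>\<^sub>E A \<and> preserves n (unary_operation (h S)) \<rho>" for S
    using two_valued_preserves_central_relation[OF assms(4) \<open>z \<in> Z\<close> \<open>a \<in> A\<close>, of "h S"]
      \<open>z \<in> A\<close> \<open>a \<in> A\<close> by (auto simp: h_def)
  have "inj_on h (Pow A)"
  proof (rule inj_on_inverseI)
    \<comment> \<open>\<open>S\<close> is recovered as the fiber of \<open>h S\<close> over
      \<open>z\<close>.\<close>
    show "{x \<in> A. h S x = z} = S" if "S \<in> Pow A" for S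
      using that \<open>z \<noteq> a\<close> by (auto simp: h_def)
  qed
  \<comment> \<open>Cantor's theorem, carried from \<open>Pow A\<close> to its image along the
    injection \<open>h\<close>.\<close>
  then have "\<not> h ` Pow A \<lesssim> A"
    using lesspoll_Pow_self lesspoll_trans2 lesspoll_not_refl by (metis inj_on_image_lepoll_1 order_refl)
  moreover have "unary_polynomials A \<Omega> \<lesssim> A"
    using assms(2,3) by (intro unary_polynomials_lepoll finite_lepoll_infinite)
  ultimately have "\<not> h ` Pow A \<subseteq> unary_polynomials A \<Omega>"
    using lepoll_trans subset_imp_lepoll by blast
  then have "\<exists>f \<in> A \<rightarrow>\<^sub>E A. preserves n (unary_operation f) \<rho> \<and> f \<notin> unary_polynomials A \<Omega>"
    using h_preserves by blast
  then show ?thesis unfolding one_central_polynomially_complete_def by blast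
qed

end
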